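(* Let $n,m,N\ge 1$ be integers, let $\phi:\mathbb{R}^n\times\mathbb{R}^m\to\mathbb{R}^n$ be Lipschitz continuous, and consider the discrete-time system $x^+=\phi(x,u)$. Let $X_G\subseteq\mathbb{R}^n$ be a target region and let $\bar x_0,\bar u_0,\bar x_1,\bar u_1,\dots,\bar x_{N-1},\bar u_{N-1},\bar x_N$ be a nominal trajectory, i.e. $\bar x_{i+1}=\phi(\bar x_i,\bar u_i)$ for $0\le i\le N-1$ and $\bar x_N\in X_G$. Assume that $\phi$ is differentiable at each $(\bar x_i,\bar u_i)$, $0\le i\le N-1$, and let $$h_{i,1}(x,u)=\bar x_{i+1}+A_i(x-\bar x_i)+B_i(u-\bar u_i),\qquad A_i=\frac{\partial\phi}{\partial x}(\bar x_i,\bar u_i),\quad B_i=\frac{\partial\phi}{\partial u}(\bar x_i,\bar u_i),$$ be the nominal linearization. Let $\mathbb{P}=[-1,1]^n$. Suppose that the polytopic tree method finds, for the nominal linearization $x^+=h_{i,1}(x,u)$ along this nominal trajectory, matrices $G_i\in\mathbb{R}^{n\times n}$ $(0\le i\le N)$ and $\theta_i\in\mathbb{R}^{m\times n}$ $(0\le i\le N-1)$, with polytopes $Y_i=\{\bar x_i\}\oplus G_i\mathbb{P}$ (see the context for what this means), and that $G_i$ has full rank for every $0\le i\le N$. For $0\le i\le N-1$, let $u_i(x)=\bar u_i+\theta_i p_i(x)$, where $p_i(x)$ is determined by $x=\bar x_i+G_i p_i(x)$. Then there exist real numbers $0<a_0\le a_1\le\cdots\le a_N=1$ such that, setting $\mathbb{P}_i=[-a_i,a_i]^n$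 and $\tilde Y_i=\{\bar x_i\}\oplus G_i\mathbb{P}_i$ for $0\le i\le N$, one has $$x\in\tilde Y_i\ \Longrightarrow\ \phi(x,u_i(x))\in\tilde Y_{i+1}\qquad\text{for all } 0\le i\le N-1.$$ Consequently, for every $i$ and every state in $\tilde Y_i$ at step $i$, the trajectory of $x^+=\phi(x,u)$ obtained by applying $u_i,u_{i+1},\dots,u_{N-1}$ successively lands in $\tilde Y_N=Y_N\subseteq X_G$.
   Context: Notation: $\oplus$ denotes the Minkowski sum, and for a matrix $G$ and a set $S$, $GS=\{Gs: s\in S\}$. Constraint regions: for each $0\le i\le N-1$, the nominal linearization $h_{i,1}$ comes with a polyhedral region $X_i^1\subseteq\mathbb{R}^n\times\mathbb{R}^m$ of admissible state-input pairs (obtained by linearizing the system's inequality constraints at $(\bar x_i,\bar u_i)$). Meaning of "the polytopic tree method finds the polytopes": the method (a linear program) returns matrices $G_i\in\mathbb{R}^{n\times n}$ for $0\le i\le N$ and $\theta_i\in\mathbb{R}^{m\times n}$ for $0\le i\le N-1$ such that, with $\mathbb{P}=[-1,1]^n$ and $Y_i=\{\bar x_i\}\oplus G_i\mathbb{P}$: (1) $G_{i+1}=A_iG_i+B_i\theta_i$ for $0\le i\le N-1$; (2) $(\bar x_i+G_ip,\ \bar u_i+\theta_ip)\in X_i^1$ for all $p\in\mathbb{P}$ and $0\le i\le N-1$; (3) $Y_N\subseteq X_G$. The associated control law at step $i$ is $u_i(x)=\bar u_i+\theta_i p_i(x)$ with $x=\bar x_i+G_ip_i(x)$. Here $p_i(x)$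 is unique because $G_i$ is a full-rank $n\times n$ matrix. *)

theory Defs
  imports "HOL-Analysis.Analysis"
begin

text \<open>
  Everything is indexed by the time step, as a function on \<^typ>\<open>nat\<close>. Values outside the
  ranges \<open>0..N\<close> (for \<open>xb\<close>, \<open>G\<close>) and \<open>0..N-1\<close> (for \<open>ub\<close>, \<open>\<theta>\<close>, \<open>X\<close>) are never constrained.
  A matrix in \<open>R^(r \<times> c)\<close> has type \<open>real^'c^'r\<close>.
\<close>

definition nominal_trajectory ::
  "((real^'n) \<times> (real^'m) \<Rightarrow> real^'n) \<Rightarrow> (real^'n) set \<Rightarrow> nat \<Rightarrow> (nat \<Rightarrow> real^'n) \<Rightarrow> (nat \<Rightarrow> real^'m) \<Rightarrow> bool"
  where "nominal_trajectory \<phi> XG N xb ub \<longleftrightarrow>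
    (\<forall>i<N. xb (Suc i) = \<phi> (xb i, ub i)) \<and> xb N \<in> XG"

definition A_mat ::
  "((real^'n) \<times> (real^'m) \<Rightarrow> real^'n) \<Rightarrow> (nat \<Rightarrow> real^'n) \<Rightarrow> (nat \<Rightarrow> real^'m) \<Rightarrow> nat \<Rightarrow> real^'n^'n"
  where "A_mat \<phi> xb ub i = jacobian (\<lambda>x. \<phi> (x, ub i)) (at (xb i))"

definition B_mat ::
  "((real^'n) \<times> (real^'m) \<Rightarrow> real^'n) \<Rightarrow> (nat \<Rightarrow> real^'n) \<Rightarrow> (nat \<Rightarrow> real^'m) \<Rightarrow> nat \<Rightarrow> real^'m^'n"
  where "B_mat \<phi> xb ub i = jacobian (\<lambda>u. \<phi> (xb i, u)) (at (ub i))"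

definition nominal_linearization ::
  "((real^'n) \<times> (real^'m) \<Rightarrow> real^'n) \<Rightarrow> (nat \<Rightarrow> real^'n) \<Rightarrow> (nat \<Rightarrow> real^'m) \<Rightarrow> nat \<Rightarrow> (real^'n) \<times> (real^'m) \<Rightarrow> real^'n"
  where "nominal_linearization \<phi> xb ub i = (\<lambda>(x, u).
    xb (Suc i) + A_mat \<phi> xb ub i *v (x - xb i) + B_mat \<phi> xb ub i *v (u - ub i))"

definition hypercube :: "real \<Rightarrow> (real^'n) set"
  where "hypercube a = cbox (vec (- a)) (vec a)"

text \<open>The sum is the Minkowski sum of sets.\<close>

definition scaled_polytope :: "real^'n \<Rightarrow> real^'n^'n \<Rightarrow> real \<Rightarrow> (real^'n) set"
  where "scaled_polytope c G a = {c} + (*v) G ` hypercube a"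

abbreviation unit_polytope :: "real^'n \<Rightarrow> real^'n^'n \<Rightarrow> (real^'n) set"
  where "unit_polytope c G \<equiv> scaled_polytope c G 1"

text \<open>
  The feasibility conditions of the linear program solved by the polytopic tree method, for
  affine dynamics with state and input matrices \<open>A i\<close>, \<open>B i\<close> along \<open>xb\<close>, \<open>ub\<close>. The constant term
  of the dynamics does not occur, see \<open>linearization_maps_unit_polytope\<close> below.
\<close>

definition polytopic_tree_finds ::
  "(nat \<Rightarrow> real^'n^'n) \<Rightarrow> (nat \<Rightarrow> real^'m^'n) \<Rightarrow> (nat \<Rightarrow> real^'n) \<Rightarrow> (nat \<Rightarrow> real^'m) \<Rightarrow>
   (nat \<Rightarrow> ((real^'n) \<times> (real^'m)) set) \<Rightarrow> (real^'n) set \<Rightarrow> nat \<Rightarrow>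
   (nat \<Rightarrow> real^'n^'n) \<Rightarrow> (nat \<Rightarrow> real^'n^'m) \<Rightarrow> bool"
  where "polytopic_tree_finds A B xb ub X XG N G \<theta> \<longleftrightarrow>
    (\<forall>i<N. G (Suc i) = A i ** G i + B i ** \<theta> i) \<and>
    (\<forall>i<N. \<forall>p\<in>hypercube 1. (xb i + G i *v p, ub i + \<theta> i *v p) \<in> X i) \<and>
    unit_polytope (xb N) (G N) \<subseteq> XG"

lemma linearization_maps_unit_polytope:
  assumes "polytopic_tree_finds (A_mat \<phi> xb ub) (B_mat \<phi> xb ub) xb ub X XG N G \<theta>" and "i < N"
  shows "nominal_linearization \<phi> xb ub i (xb i + G i *v p, ub i + \<theta> i *v p)
    = xb (Suc i) + G (Suc i) *v p"
  using assms
  by (simp add: polytopic_tree_finds_def nominal_linearization_def matrix_vector_mul_assoc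
      matrix_vector_mult_add_rdistrib)

text \<open>The description below determines \<open>p\<close> uniquely when \<open>G\<close> has full rank.\<close>

definition polytope_coord :: "real^'n \<Rightarrow> real^'n^'n \<Rightarrow> real^'n \<Rightarrow> real^'n"
  where "polytope_coord c G x = (THE p. x = c + G *v p)"

definition control_law ::
  "(nat \<Rightarrow> real^'n) \<Rightarrow> (nat \<Rightarrow> real^'m) \<Rightarrow> (nat \<Rightarrow> real^'n^'n) \<Rightarrow> (nat \<Rightarrow> real^'n^'m) \<Rightarrow>
   nat \<Rightarrow> real^'n \<Rightarrow> real^'m"
  where "control_law xb ub G \<theta> i x = ub i + \<theta> i *v polytope_coord (xb i) (G i) x"

text \<open>
  \<open>closed_loop \<phi> v i x k\<close> is the state at step \<open>i + k\<close> of the trajectory that is in state \<open>x\<close>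
  at step \<open>i\<close> and along which \<open>v i, v (i + 1), \<dots>, v (i + k - 1)\<close> are applied.
\<close>

primrec closed_loop ::
  "((real^'n) \<times> (real^'m) \<Rightarrow> real^'n) \<Rightarrow> (nat \<Rightarrow> real^'n \<Rightarrow> real^'m) \<Rightarrow> nat \<Rightarrow> real^'n \<Rightarrow> nat \<Rightarrow> real^'n"
  where
    "closed_loop \<phi> v i x 0 = x"
  | "closed_loop \<phi> v i x (Suc k) =
      \<phi> (closed_loop \<phi> v i x k, v (i + k) (closed_loop \<phi> v i x k))"

end

theory Submission
  imports Defs
begin

text \<open>
  In coordinates, the closed-loop step \<open>p \<mapsto> \<phi> (xb i + G i p, ub i + \<theta> i p)\<close> is continuous and sends
  \<open>0\<close> to \<open>xb (Suc i)\<close>, while full rank of \<open>G (Suc i)\<close> makes every polytope around \<open>xb (Suc i)\<close> a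
  neighbourhood of its centre. So the radii can be chosen backwards from \<open>a N = 1\<close>, each small
  enough for the next.
\<close>

lemma mem_hypercube: "p \<in> hypercube a \<longleftrightarrow> (\<forall>i. \<bar>p $ i\<bar> \<le> a)"
  by (auto simp: hypercube_def mem_box_cart abs_le_iff minus_le_iff)

text \<open>Crude comparison through the l1 norm; it turns a Euclidean radius from continuity into a
  half-width of a cube.\<close>

lemma norm_le_hypercube:
  fixes p :: "real^'n"
  assumes "p \<in> hypercube a"
  shows "norm p \<le> real CARD('n) * a"
proof -
  have "norm p \<le> (\<Sum>i\<in>UNIV. \<bar>p $ i\<bar>)"
    by (rule norm_le_l1_cart)
  also have "\<dots> \<le> (\<Sum>i\<in>(UNIV::'n set). a)"
    using assms by (intro sum_mono) (auto simp: mem_hypercube)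
  finally show ?thesis by simp
qed

lemma mem_scaled_polytope:
  "x \<in> scaled_polytope c G a \<longleftrightarrow> (\<exists>p\<in>hypercube a. x = c + G *v p)"
  by (auto simp: scaled_polytope_def set_plus_def)

lemma polytope_coord_eq:
  assumes "rank (G :: real^'n^'n) = CARD('n)"
  shows "polytope_coord c G (c + G *v p) = p"
  using assms unfolding polytope_coord_def full_rank_injective inj_def
  by (intro the_equality) auto

text \<open>Invertibility of \<open>H\<close> turns membership in the polytope around
  \<open>g 0\<close> into a bound on the coordinates of \<open>g p - g 0\<close> with respect to
  \<open>H\<close>. These depend continuously on \<open>p\<close> at \<open>0\<close> and vanish
  there.\<close>

lemma continuous_maps_hypercube_into_polytope:
  fixes g :: "real^'n \<Rightarrow> real^'k" and H :: "real^'k^'k"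
  assumes "isCont g 0" and "rank H = CARD('k)" and "b > 0"
  shows "\<exists>a>0. a \<le> b \<and> (\<forall>p\<in>hypercube a. g p \<in> scaled_polytope (g 0) H b)"
proof -
  have "inj ((*v) H)"
    using assms(2) by (simp add: full_rank_injective)
  then obtain K where K: "K ** H = mat 1"
    using matrix_left_invertible_injective by blast
  then have HK: "H ** K = mat 1"
    by (simp add: matrix_left_right_inverse)
  \<comment> \<open>\<open>K\<close> inverts \<open>H\<close>, so \<open>q p\<close> is the
    coordinate vector of \<open>g p\<close> in the target polytope; \<open>H ** K = mat 1\<close>
    later recovers \<open>g p\<close> from it.\<close>
  define q where "q = (\<lambda>p. K *v (g p - g 0))"
  have "isCont q 0"
    unfolding q_def using assms(1)
    by (intro bounded_linear.isCont[OF matrix_vector_mul_bounded_linear] continuous_diff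
        continuous_const)
  moreover have "q 0 = 0"
    by (simp add: q_def)
  ultimately have "\<forall>e>0. \<exists>d>0. \<forall>p. norm p < d \<longrightarrow> norm (q p) < e"
    by (simp add: continuous_at_eps_delta dist_norm)
  then obtain d where d: "d > 0" "\<And>p. norm p < d \<Longrightarrow> norm (q p) < b"
    using assms(3) by blast
  \<comment> \<open>The minimum with \<open>b\<close> gives \<open>a \<le> b\<close>. The dimension
    cancels the factor in \<open>norm_le_hypercube\<close>, and the 2 makes the bound by
    \<open>d\<close> strict.\<close>
  define a where "a = min b (d / (2 * real CARD('n)))"
  have "g p \<in> scaled_polytope (g 0) H b" if "p \<in> hypercube a" for p
  proof -
    have "norm p \<le> real CARD('n) * a"
      using that by (rule norm_le_hypercube)
    also have "\<dots> \<le> real CARD('n) * (d / (2 * real CARD('n)))"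
      by (intro mult_left_mono) (auto simp: a_def)
    also have "\<dots> < d"
      using d(1) by simp
    finally have "norm (q p) < b"
      by (rule d(2))
    then have "q p \<in> hypercube b"
      unfolding mem_hypercube by (meson component_le_norm_cart less_imp_le order_trans)
    moreover have "g p = g 0 + H *v q p"
      by (simp add: q_def matrix_vector_mul_assoc HK)
    ultimately show ?thesis
      by (auto simp: mem_scaled_polytope)
  qed
  moreover have "a > 0" "a \<le> b"
    using d(1) assms(3) by (auto simp: a_def)
  ultimately show ?thesis by blast
qed

text \<open>The end value \<open>b\<close> is generalised in the induction: the last link is chosen
  first, and the radius it yields becomes the end value of the shorter chain. Monotonicity carries
  positivity from \<open>a 0\<close> to all later radii.\<close>

lemma backward_choice:
  fixes b :: real
  assumes "\<And>i b. i < N \<Longrightarrow> b > 0 \<Longrightarrow> \<exists>a>0. a \<le> b \<and> P i a b" and "b > 0"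
  shows "\<exists>a :: nat \<Rightarrow> real. 0 < a 0 \<and> a N = b \<and> (\<forall>i<N. a i \<le> a (Suc i) \<and> P i (a i) (a (Suc i)))"
  using assms
proof (induction N arbitrary: b)
  case 0
  then show ?case by (intro exI[of _ "\<lambda>_. b"]) auto
next
  case (Suc N)
  from Suc.prems obtain c where c: "c > 0" "c \<le> b" "P N c b"
    using Suc.prems(1)[OF lessI] by blast
  obtain a where a: "0 < a 0" "a N = c" "\<forall>i<N. a i \<le> a (Suc i) \<and> P i (a i) (a (Suc i))"
    using Suc.IH[OF Suc.prems(1)[OF less_SucI] c(1)] by blast
  then show ?case
    \<comment> \<open>The update leaves \<open>a N = c\<close> in place, so the new link is exactly
      \<open>P N c b\<close>.\<close>
    using c by (intro exI[of _ "a(Suc N := b)"]) (auto simp: less_Suc_eq)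
qed

lemma closed_loop_invariant:
  assumes "\<And>j y. j < N \<Longrightarrow> y \<in> S j \<Longrightarrow> \<phi> (y, v j y) \<in> S (Suc j)"
    and "x \<in> S i" and "i + k \<le> N"
  shows "closed_loop \<phi> v i x k \<in> S (i + k)"
  using assms(3) by (induction k) (use assms(1,2) in auto)

theorem proposition1:
  fixes \<phi> :: "(real^'n) \<times> (real^'m) \<Rightarrow> real^'n"
    and N :: nat
    and XG :: "(real^'n) set"
    and xb :: "nat \<Rightarrow> real^'n"
    and ub :: "nat \<Rightarrow> real^'m"
    and X :: "nat \<Rightarrow> ((real^'n) \<times> (real^'m)) set"
    and G :: "nat \<Rightarrow> real^'n^'n"
    and \<theta> :: "nat \<Rightarrow> real^'n^'m"
  assumes "N \<ge> 1"
    and "\<exists>L. L-lipschitz_on UNIV \<phi>"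
    and "nominal_trajectory \<phi> XG N xb ub"
    and "\<And>i. i < N \<Longrightarrow> \<phi> differentiable at (xb i, ub i)"
    and "\<And>i. i < N \<Longrightarrow> polyhedron (X i)"
    and "polytopic_tree_finds (A_mat \<phi> xb ub) (B_mat \<phi> xb ub) xb ub X XG N G \<theta>"
    and "\<And>i. i \<le> N \<Longrightarrow> rank (G i) = CARD('n)"
  shows "\<exists>a :: nat \<Rightarrow> real.
    0 < a 0 \<and> (\<forall>i<N. a i \<le> a (Suc i)) \<and> a N = 1 \<and>
    (\<forall>i<N. \<forall>x \<in> scaled_polytope (xb i) (G i) (a i).
      \<phi> (x, control_law xb ub G \<theta> i x) \<in> scaled_polytope (xb (Suc i)) (G (Suc i)) (a (Suc i))) \<and>
    (\<forall>i\<le>N. \<forall>x \<in> scaled_polytope (xb i) (G i) (a i).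
      closed_loop \<phi> (control_law xb ub G \<theta>) i x (N - i) \<in> scaled_polytope (xb N) (G N) (a N)) \<and>
    scaled_polytope (xb N) (G N) (a N) = unit_polytope (xb N) (G N) \<and>
    unit_polytope (xb N) (G N) \<subseteq> XG"
proof -
  obtain L where "L-lipschitz_on UNIV \<phi>"
    using assms(2) by blast
  then have cont: "isCont \<phi> z" for z
    using lipschitz_on_continuous_on continuous_on_eq_continuous_at open_UNIV by blast
  define P where "P i a b \<longleftrightarrow> (\<forall>x\<in>scaled_polytope (xb i) (G i) a.
      \<phi> (x, control_law xb ub G \<theta> i x) \<in> scaled_polytope (xb (Suc i)) (G (Suc i)) b)" for i a b
  have step: "\<exists>a>0. a \<le> b \<and> P i a b" if i: "i < N" and b: "b > 0" for i b
  proof -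
    \<comment> \<open>Working with \<open>p\<close> instead of \<open>x\<close> avoids proving
      continuity of \<open>control_law\<close>, which is defined through a definite
      description.\<close>
    define g where "g = (\<lambda>p. \<phi> (xb i + G i *v p, ub i + \<theta> i *v p))"
    have "isCont g 0"
      unfolding g_def
      by (rule isCont_o2[OF _ cont], intro continuous_Pair continuous_add continuous_const
          bounded_linear.isCont[OF matrix_vector_mul_bounded_linear] continuous_ident)
    moreover have "g 0 = xb (Suc i)"
      using assms(3) i by (simp add: g_def nominal_trajectory_def)
    moreover have "rank (G (Suc i)) = CARD('n)"
      using assms(7) i by simp
    ultimately obtain a where a: "a > 0" "a \<le> b"
      "\<forall>p\<in>hypercube a. g p \<in> scaled_polytope (xb (Suc i)) (G (Suc i)) b"
      using continuous_maps_hypercube_into_polytope b by metis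
    \<comment> \<open>Here the rank of \<open>G i\<close> matters: the coordinates of a state are
      unique, so \<open>g p\<close> is the successor of the state under the control law. The rank of
      \<open>G (Suc i)\<close> served the target polytope.\<close>
    moreover have "control_law xb ub G \<theta> i (xb i + G i *v p) = ub i + \<theta> i *v p" for p
      using assms(7)[of i] i by (simp add: control_law_def polytope_coord_eq)
    ultimately have "P i a b"
      by (auto simp: P_def g_def mem_scaled_polytope[of _ "xb i"])
    with a(1,2) show ?thesis by blast
  qed
  obtain a where a: "0 < a 0" "a N = 1" "\<forall>i<N. a i \<le> a (Suc i) \<and> P i (a i) (a (Suc i))"
    using backward_choice[of N P 1] step by auto
  have "closed_loop \<phi> (control_law xb ub G \<theta>) i x (N - i) \<in> scaled_polytope (xb N) (G N) (a N)"
    if "i \<le> N" "x \<in> scaled_polytope (xb i) (G i) (a i)" for i x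
    \<comment> \<open>With \<open>N - i\<close> steps the final index \<open>i + (N - i)\<close> is
      \<open>N\<close>.\<close>
    using closed_loop_invariant[of N "\<lambda>i. scaled_polytope (xb i) (G i) (a i)" \<phi>
        "control_law xb ub G \<theta>" x i "N - i"] a(3) that
    by (auto simp: P_def)
  moreover have "unit_polytope (xb N) (G N) \<subseteq> XG"
    using assms(6) by (simp add: polytopic_tree_finds_def)
  ultimately show ?thesis
    using a by (intro exI[of _ a]) (auto simp: P_def)
qed

end
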